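(* Let $(X,T)$ be a positively expansive and topologically mixing dynamical system with the local specification property. Let $\epsilon>0$, let $\mathcal U$ be a finite collection of open subsets of $X$, let $k,n\in\mathbb N$ and let $h:X\to\mathbb R$ be a function. Then for any CLT-admissible $F_{\mathcal P}=\prod_{i=1}^kE_i\in\Pi(\mathcal U)$, with associated bijection $\Phi:F_{\mathcal P}\to\mathcal P$ and $(x_1(p),\dots,x_k(p))=\Phi^{-1}(p)$ for $p\in\mathcal P$, one has $$\mathrm{Var}_{\mathrm{tot}}=\mathrm{Var}_{\mathrm{per}}+\mathrm{Var}_{\mathrm{loc}}+\mathrm{Var}_{\text{Höl}}+2\,\mathrm{Cov}_{\mathrm{per},\mathrm{loc}+\text{Höl}},$$ where $$\mathrm{Cov}_{\mathrm{per},\mathrm{loc}+\text{Höl}}=\sum_{p\in\mathcal P}\sum_{i=1}^k\left(h(T^{(i-1)n}p)-h(x_i(p))\right)\left(h(x_i(p))-\mathbb E_{P_{kn}}(h)\right).$$ Moreover, $$\mathrm{Cov}_{\mathrm{per},\mathrm{loc}+\text{Höl}}\leqslant\sqrt{\mathrm{Var}_{\mathrm{per}}\left(\mathrm{Var}_{\mathrm{loc}}+\mathrm{Var}_{\text{Höl}}\right)}.$$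
   Context: $(X,d)$ is a compact metric space and $T:X\to X$ is continuous. $P_n=\{x\in X:T^nx=x\}$; each $P_n$ is finite. $d_n(x,y)=\sup_{0\leqslant k\leqslant n-1}d(T^kx,T^ky)$, $B^n_\epsilon(x)=\{y\in X:d_n(x,y)<\epsilon\}$. $T$ is positively expansive if for some $\epsilon^*>0$, for all $x\ne y$ there is $n\in\mathbb N$ with $d(T^nx,T^ny)>\epsilon^*$. Local specification: for any $\epsilon>0$ there exist $\delta>0$ and $N(\epsilon)\in\mathbb N$ such that for any $k\in\mathbb N$, $n\geqslant N(\epsilon)$ and $x_1,\dots,x_k\in X$ with $d(T^nx_i,x_{i+1})<\delta$ for $i=1,\dots,k$ ($x_{k+1}=x_1$) there is $p\in P_{kn}$ with $T^{(i-1)n}p\in B^n_\epsilon(x_i)$ for all $i$. For a finite set $Z$, $\mathbb E_Z$ is the expectation with respect to the uniform probability on $Z$. Let $\alpha=\bigvee_{i=0}^{k-1}T^{-in}\mathcal U$, the family of sets $\bigcap_{i=0}^{k-1}T^{-in}U_i$ with $U_i\in\mathcal U$. A (nonempty) set $\mathcal P\subset P_{kn}$ is locally $\epsilon$-independent with respect to $A\in\alpha$ if there exist $E_i\subset T^{(i-1)n}A$, $1\leqslant i\leqslant k$, and a bijection $\Phi$ from $F_{\mathcal P}=\prod_{i=1}^kE_i$ to $\mathcal P$ such that $T^{(i-1)n}(\Phi(\mathbf x))\in B^n_\epsilon(x_i)$ for all $\mathbf x=(x_1,\dots,x_k)\in F_{\mathcal P}$ and $1\leqslant i\leqslant k$.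 Each such $\mathcal P$ comes with its product set $F_{\mathcal P}$ and bijection $\Phi$. The variation by periodic orbits is $$\mathrm{Var}_{\mathrm{per}}=\min\Big\{\sum_{\mathbf x\in F_{\mathcal P}}\sum_{i=1}^k\left(h(T^{(i-1)n}\Phi(\mathbf x))-h(x_i)\right)^2\Big\},$$ the minimum being over all possible choices of $F_{\mathcal P}$ (with its $\Phi$) of nonempty sets $\mathcal P\subset P_{kn}$ that are locally $\epsilon$-independent with respect to some $A\in\alpha$. $\Pi(\mathcal U)$ is the collection of all $F_{\mathcal P}$ (with its $\Phi$) at which this minimum is attained. The local variation is $$\mathrm{Var}_{\mathrm{loc}}=\min\Big\{\sum_{\mathbf x\in F_{\mathcal P}}\sum_{i=1}^k\left(h(x_i)-\mathbb E_{E_i}(h)\right)^2: F_{\mathcal P}\in\Pi(\mathcal U)\Big\}.$$ $F_{\mathcal P}\in\Pi(\mathcal U)$ is CLT-admissible for $h$ if it attains the minimum in $\mathrm{Var}_{\mathrm{loc}}$ (and hence also that in $\mathrm{Var}_{\mathrm{per}}$). For $F_{\mathcal P}\in\Pi(\mathcal U)$, $$\mathrm{Var}_{\text{Höl}}=|F_{\mathcal P}|\sum_{i=1}^k\left(\mathbb E_{E_i}(h)-\mathbb E_{P_{kn}}(h)\right)^2,\qquad \mathrm{Var}_{\mathrm{tot}}=\sum_{p\in\mathcal P}\sum_{i=1}^k\left(h(T^{(i-1)n}p)-\mathbb E_{P_{kn}}(h)\right)^2.$$ *)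

theory Defs
  imports "HOL-Probability.Probability"
begin

definition periodic_points :: "('a \<Rightarrow> 'a) \<Rightarrow> nat \<Rightarrow> 'a set" where
  "periodic_points T n = {x. (T ^^ n) x = x}"

definition bowen_dist :: "('a::metric_space \<Rightarrow> 'a) \<Rightarrow> nat \<Rightarrow> 'a \<Rightarrow> 'a \<Rightarrow> real" where
  "bowen_dist T n x y = (SUP j\<in>{..<n}. dist ((T ^^ j) x) ((T ^^ j) y))"

definition bowen_ball :: "('a::metric_space \<Rightarrow> 'a) \<Rightarrow> nat \<Rightarrow> real \<Rightarrow> 'a \<Rightarrow> 'a set" where
  "bowen_ball T n \<epsilon> x = {y. bowen_dist T n x y < \<epsilon>}"

(* The separation time n may be 0, as is standard: for n >= 1 only, T would have to be injective. *)
definition positively_expansive :: "('a::metric_space \<Rightarrow> 'a) \<Rightarrow> bool" where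
  "positively_expansive T \<longleftrightarrow>
     (\<exists>e>0. \<forall>x y. x \<noteq> y \<longrightarrow> (\<exists>n. dist ((T ^^ n) x) ((T ^^ n) y) > e))"

definition topologically_mixing :: "('a::topological_space \<Rightarrow> 'a) \<Rightarrow> bool" where
  "topologically_mixing T \<longleftrightarrow>
     (\<forall>U V. open U \<longrightarrow> open V \<longrightarrow> U \<noteq> {} \<longrightarrow> V \<noteq> {} \<longrightarrow>
        (\<exists>N. \<forall>n\<ge>N. (T ^^ n) ` U \<inter> V \<noteq> {}))"

definition local_specification :: "('a::metric_space \<Rightarrow> 'a) \<Rightarrow> bool" where
  "local_specification T \<longleftrightarrow>
     (\<forall>\<epsilon>>0. \<exists>\<delta>>0. \<exists>N\<ge>1. \<forall>k\<ge>1. \<forall>n\<ge>N. \<forall>x :: nat \<Rightarrow> 'a.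
        (\<forall>i\<in>{1..k}. dist ((T ^^ n) (x i)) (x (if i = k then 1 else i + 1)) < \<delta>) \<longrightarrow>
        (\<exists>p\<in>periodic_points T (k * n).
           \<forall>i\<in>{1..k}. (T ^^ ((i - 1) * n)) p \<in> bowen_ball T n \<epsilon> (x i)))"

(* The expectation over the periodic points used below is therefore one over a finite set. *)
lemma finite_periodic_points:
  fixes T :: "'a::metric_space \<Rightarrow> 'a"
  assumes "compact (UNIV :: 'a set)" and cont: "continuous_on UNIV T"
    and "positively_expansive T" and n: "n \<ge> 1"
  shows "finite (periodic_points T n)"
proof (rule ccontr)
  assume "infinite (periodic_points T n)"
  then obtain z where z: "z islimpt periodic_points T n"
    using assms(1) by (metis UNIV_I subset_UNIV Heine_Borel_imp_Bolzano_Weierstrass)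
  obtain e where e: "e > 0"
      "\<And>x y. x \<noteq> y \<Longrightarrow> \<exists>m. dist ((T ^^ m) x) ((T ^^ m) y) > e"
    using assms(3) unfolding positively_expansive_def by blast
  have contj: "continuous_on UNIV (T ^^ j)" for j
  proof (induction j)
    case (Suc j)
    then show ?case
      using continuous_on_compose[OF Suc continuous_on_subset[OF cont subset_UNIV]]
      by (simp add: comp_def)
  qed (simp add: id_def)
  have "\<exists>d>0. \<forall>w. dist w z < d \<longrightarrow> dist ((T ^^ j) w) ((T ^^ j) z) < e / 2" for j
    using contj[of j] e(1) unfolding continuous_on_iff by (meson UNIV_I half_gt_zero)
  then obtain d where d: "\<And>j. d j > 0"
      "\<And>j w. dist w z < d j \<Longrightarrow> dist ((T ^^ j) w) ((T ^^ j) z) < e / 2"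
    by metis
  define r where "r = Min (d ` {..<n})"
  have r: "r > 0" "\<And>j. j < n \<Longrightarrow> r \<le> d j"
    using n d(1) by (auto simp: r_def Min_gr_iff lessThan_empty_iff)
  have "infinite (periodic_points T n \<inter> ball z r)"
    using z r(1) by (simp add: islimpt_eq_infinite_ball)
  then obtain v w where vw: "v \<in> periodic_points T n \<inter> ball z r"
      "w \<in> periodic_points T n \<inter> ball z r" "v \<noteq> w"
    by (metis finite.emptyI finite.insertI finite_subset insertCI subsetI)
  have per: "(T ^^ m) u = (T ^^ (m mod n)) u" if "u \<in> periodic_points T n" for u m
    using that by (simp add: periodic_points_def funpow_mod_eq)
  obtain m where m: "dist ((T ^^ m) v) ((T ^^ m) w) > e"
    using e(2) vw(3) by blast
  define j where "j = m mod n"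
  have "j < n" using n by (simp add: j_def)
  have "dist ((T ^^ j) v) ((T ^^ j) z) < e / 2" "dist ((T ^^ j) w) ((T ^^ j) z) < e / 2"
    using d(2) r(2)[OF \<open>j < n\<close>] vw(1,2) by (fastforce simp: dist_commute)+
  then have "dist ((T ^^ j) v) ((T ^^ j) w) < e"
    by (metis dist_triangle_half_l)
  moreover have "dist ((T ^^ j) v) ((T ^^ j) w) > e"
    using m per vw(1,2) by (metis IntD1 j_def)
  ultimately show False by simp
qed

definition pullback_join :: "('a \<Rightarrow> 'a) \<Rightarrow> 'a set set \<Rightarrow> nat \<Rightarrow> nat \<Rightarrow> 'a set set" where
  "pullback_join T \<U> k n = {\<Inter>i\<in>{..<k}. (T ^^ (i * n)) -` U i | U. \<forall>i<k. U i \<in> \<U>}"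

(* A tuple in the product set is a function in the extensional dependent product over {1..k};
   it suffices to carry the factors E, as they determine the product set PiE {1..k} E. *)
definition locally_independent ::
  "('a::metric_space \<Rightarrow> 'a) \<Rightarrow> real \<Rightarrow> nat \<Rightarrow> nat \<Rightarrow> 'a set \<Rightarrow>
   'a set \<Rightarrow> (nat \<Rightarrow> 'a set) \<Rightarrow> ((nat \<Rightarrow> 'a) \<Rightarrow> 'a) \<Rightarrow> bool" where
  "locally_independent T \<epsilon> k n A P E \<Phi> \<longleftrightarrow>
     P \<noteq> {} \<and> P \<subseteq> periodic_points T (k * n) \<and>
     (\<forall>i\<in>{1..k}. E i \<subseteq> (T ^^ ((i - 1) * n)) ` A) \<and>
     bij_betw \<Phi> (PiE {1..k} E) P \<and>
     (\<forall>x\<in>PiE {1..k} E. \<forall>i\<in>{1..k}. (T ^^ ((i - 1) * n)) (\<Phi> x) \<in> bowen_ball T n \<epsilon> (x i))"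

type_synonym 'a product_choice = "'a set \<times> (nat \<Rightarrow> 'a set) \<times> ((nat \<Rightarrow> 'a) \<Rightarrow> 'a)"

definition product_choices ::
  "('a::metric_space \<Rightarrow> 'a) \<Rightarrow> real \<Rightarrow> 'a set set \<Rightarrow> nat \<Rightarrow> nat \<Rightarrow> 'a product_choice set" where
  "product_choices T \<epsilon> \<U> k n =
     {(P, E, \<Phi>). \<exists>A\<in>pullback_join T \<U> k n. locally_independent T \<epsilon> k n A P E \<Phi>}"

abbreviation unif_expectation :: "'a set \<Rightarrow> ('a \<Rightarrow> real) \<Rightarrow> real" where
  "unif_expectation Z h \<equiv> measure_pmf.expectation (pmf_of_set Z) h"

definition per_sum ::
  "('a \<Rightarrow> 'a) \<Rightarrow> ('a \<Rightarrow> real) \<Rightarrow> nat \<Rightarrow> nat \<Rightarrow> 'a product_choice \<Rightarrow> real" where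
  "per_sum T h k n = (\<lambda>(P, E, \<Phi>).
     \<Sum>x\<in>PiE {1..k} E. \<Sum>i=1..k. (h ((T ^^ ((i - 1) * n)) (\<Phi> x)) - h (x i))\<^sup>2)"

definition loc_sum :: "('a \<Rightarrow> real) \<Rightarrow> nat \<Rightarrow> 'a product_choice \<Rightarrow> real" where
  "loc_sum h k = (\<lambda>(P, E, \<Phi>).
     \<Sum>x\<in>PiE {1..k} E. \<Sum>i=1..k. (h (x i) - unif_expectation (E i) h)\<^sup>2)"

(* There may be infinitely many choices, so Min is not available; LEAST on the reals denotes the
   minimum of the set of values whenever it is attained. *)
definition Var_per ::
  "('a::metric_space \<Rightarrow> 'a) \<Rightarrow> ('a \<Rightarrow> real) \<Rightarrow> real \<Rightarrow> 'a set set \<Rightarrow> nat \<Rightarrow> nat \<Rightarrow> real" where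
  "Var_per T h \<epsilon> \<U> k n = (LEAST v. v \<in> per_sum T h k n ` product_choices T \<epsilon> \<U> k n)"

definition Pi_min ::
  "('a::metric_space \<Rightarrow> 'a) \<Rightarrow> ('a \<Rightarrow> real) \<Rightarrow> real \<Rightarrow> 'a set set \<Rightarrow> nat \<Rightarrow> nat \<Rightarrow>
   'a product_choice set" where
  "Pi_min T h \<epsilon> \<U> k n =
     {F. is_arg_min (per_sum T h k n) (\<lambda>F. F \<in> product_choices T \<epsilon> \<U> k n) F}"

definition Var_loc ::
  "('a::metric_space \<Rightarrow> 'a) \<Rightarrow> ('a \<Rightarrow> real) \<Rightarrow> real \<Rightarrow> 'a set set \<Rightarrow> nat \<Rightarrow> nat \<Rightarrow> real" where
  "Var_loc T h \<epsilon> \<U> k n = (LEAST v. v \<in> loc_sum h k ` Pi_min T h \<epsilon> \<U> k n)"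

definition CLT_admissible ::
  "('a::metric_space \<Rightarrow> 'a) \<Rightarrow> ('a \<Rightarrow> real) \<Rightarrow> real \<Rightarrow> 'a set set \<Rightarrow> nat \<Rightarrow> nat \<Rightarrow>
   'a product_choice \<Rightarrow> bool" where
  "CLT_admissible T h \<epsilon> \<U> k n F \<longleftrightarrow>
     is_arg_min (loc_sum h k) (\<lambda>F. F \<in> Pi_min T h \<epsilon> \<U> k n) F"

definition Var_Hoel ::
  "('a \<Rightarrow> 'a) \<Rightarrow> ('a \<Rightarrow> real) \<Rightarrow> nat \<Rightarrow> nat \<Rightarrow> (nat \<Rightarrow> 'a set) \<Rightarrow> real" where
  "Var_Hoel T h k n E =
     real (card (PiE {1..k} E)) *
     (\<Sum>i=1..k. (unif_expectation (E i) h - unif_expectation (periodic_points T (k * n)) h)\<^sup>2)"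

definition Var_tot ::
  "('a \<Rightarrow> 'a) \<Rightarrow> ('a \<Rightarrow> real) \<Rightarrow> nat \<Rightarrow> nat \<Rightarrow> 'a set \<Rightarrow> real" where
  "Var_tot T h k n P =
     (\<Sum>p\<in>P. \<Sum>i=1..k. (h ((T ^^ ((i - 1) * n)) p)
                          - unif_expectation (periodic_points T (k * n)) h)\<^sup>2)"

definition Cov_per_loc_Hoel ::
  "('a \<Rightarrow> 'a) \<Rightarrow> ('a \<Rightarrow> real) \<Rightarrow> nat \<Rightarrow> nat \<Rightarrow> 'a product_choice \<Rightarrow> real" where
  "Cov_per_loc_Hoel T h k n = (\<lambda>(P, E, \<Phi>).
     let x = inv_into (PiE {1..k} E) \<Phi> in
     \<Sum>p\<in>P. \<Sum>i=1..k. (h ((T ^^ ((i - 1) * n)) p) - h (x p i)) *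
                        (h (x p i) - unif_expectation (periodic_points T (k * n)) h))"

end

theory Submission
  imports Defs
begin

text \<open>
  Write \<open>m\<close> for the mean of \<open>h\<close> over the periodic points and fix a point \<open>p = \<Phi> x\<close> of \<open>P\<close>. Its deviation
  splits at each \<open>i\<close> as \<open>h (y i) - m = (h (y i) - h (x i)) + (h (x i) - m)\<close>, where
  \<open>y i = (T ^^ ((i - 1) * n)) p\<close> is the orbit point that shadows \<open>x i\<close>. Squaring and
  summing over \<open>p\<close> and \<open>i\<close> gives the first sum of squares, which is the variation by periodic
  orbits, the second sum of squares, and twice the covariance; the bound on the covariance is then
  the Cauchy--Schwarz inequality.

  The second sum of squares is the local plus the Hoelder variation. This is where the product
  structure is used: under the uniform distribution on \<open>PiE {1..k} E\<close> the coordinate \<open>x i\<close> is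
  uniform on \<open>E i\<close> (lemma \<open>sum_PiE_coordinate\<close>), so its mean square deviation from \<open>m\<close> is its variance
  plus the squared distance from its own mean to \<open>m\<close> (lemma \<open>sum_PiE_square_deviation\<close>).

  A continuous positively expansive map of a compact space has finitely many periodic points of each
  period, so \<open>P\<close> and all factors \<open>E i\<close> are finite and the sums and means are genuine ones.
  Admissibility says that the given product set attains both minima, so each minimum may be replaced
  by the corresponding sum over this product set.
\<close>

lemma Least_image_eq_arg_min:
  fixes f :: "'a \<Rightarrow> 'b::linorder"
  assumes "is_arg_min f (\<lambda>x. x \<in> S) a"
  shows "(LEAST v. v \<in> f ` S) = f a"
  using assms by (intro Least_equality) (auto simp: is_arg_min_linorder)

lemma finite_nonempty_factors_if_PiE:
  assumes "finite (PiE I E)" "PiE I E \<noteq> {}" "i \<in> I"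
  shows "finite (E i)" "E i \<noteq> {}"
  using assms by (auto simp: finite_PiE_iff PiE_eq_empty_iff)

text \<open>
  The uniform distribution on a finite product set is the product of the uniform distributions on the
  factors, so its marginals are uniform again.
\<close>

lemma sum_PiE_coordinate:
  fixes f :: "'b \<Rightarrow> real"
  assumes I: "finite I" "i \<in> I"
    and E: "\<And>j. j \<in> I \<Longrightarrow> finite (E j)" "\<And>j. j \<in> I \<Longrightarrow> E j \<noteq> {}"
  shows "(\<Sum>x\<in>PiE I E. f (x i)) = real (card (PiE I E)) * unif_expectation (E i) f"
proof -
  have fin: "finite (PiE I E)" and ne: "PiE I E \<noteq> {}"
    using I E by (auto intro: finite_PiE simp: PiE_eq_empty_iff)
  (* the extensional product has the default value undefined outside the index set *)
  have "PiE_dflt I undefined E = PiE I E"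
    by (auto simp: PiE_dflt_def PiE_def Pi_def extensional_def)
  then have "map_pmf (\<lambda>x. x i) (pmf_of_set (PiE I E)) = pmf_of_set (E i)"
    using I E Pi_pmf_of_set[of I E undefined]
      Pi_pmf_component[OF I(1), of i undefined "\<lambda>j. pmf_of_set (E j)"] by simp
  then have "unif_expectation (E i) f = unif_expectation (PiE I E) (\<lambda>x. f (x i))"
    by (metis integral_map_pmf)
  also have "\<dots> = (\<Sum>x\<in>PiE I E. f (x i)) / real (card (PiE I E))"
    using fin ne by (simp add: integral_pmf_of_set)
  finally show ?thesis
    using fin ne by simp
qed

text \<open>
  The classical decomposition of a mean square error into variance and squared bias, for one
  coordinate: the cross term vanishes because the deviations of \<open>h (x i)\<close> from its mean sum to zero.
\<close>

lemma sum_PiE_square_deviation: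
  fixes h :: "'b \<Rightarrow> real"
  assumes "finite I" "i \<in> I"
    and "\<And>j. j \<in> I \<Longrightarrow> finite (E j)" "\<And>j. j \<in> I \<Longrightarrow> E j \<noteq> {}"
  shows "(\<Sum>x\<in>PiE I E. (h (x i) - m)\<^sup>2) =
    (\<Sum>x\<in>PiE I E. (h (x i) - unif_expectation (E i) h)\<^sup>2)
      + real (card (PiE I E)) * (unif_expectation (E i) h - m)\<^sup>2"
proof -
  define c where "c = unif_expectation (E i) h"
  have centred: "(\<Sum>x\<in>PiE I E. h (x i) - c) = 0"
    using sum_PiE_coordinate[OF assms] by (simp add: sum_subtractf c_def)
  have "(\<Sum>x\<in>PiE I E. (h (x i) - m)\<^sup>2) =
      (\<Sum>x\<in>PiE I E. (h (x i) - c)\<^sup>2 + (c - m)\<^sup>2 + 2 * (c - m) * (h (x i) - c))"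
    by (intro sum.cong refl) (simp add: power2_eq_square algebra_simps)
  also have "\<dots> = (\<Sum>x\<in>PiE I E. (h (x i) - c)\<^sup>2) + real (card (PiE I E)) * (c - m)\<^sup>2"
    using centred by (simp add: sum.distrib flip: sum_distrib_left)
  finally show ?thesis
    by (simp add: c_def)
qed

theorem theorem6p5:
  fixes T :: "'a::metric_space \<Rightarrow> 'a"
    and h :: "'a \<Rightarrow> real"
    and \<epsilon> :: real
    and \<U> :: "'a set set"
    and k n :: nat
    and P :: "'a set"
    and E :: "nat \<Rightarrow> 'a set"
    and \<Phi> :: "(nat \<Rightarrow> 'a) \<Rightarrow> 'a"
  assumes "compact (UNIV :: 'a set)"
    and "continuous_on UNIV T"
    and "positively_expansive T"
    and "topologically_mixing T"
    and "local_specification T"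
    and "\<epsilon> > 0"
    and "finite \<U>" and "\<forall>U\<in>\<U>. open U"
    and "k \<ge> 1" and "n \<ge> 1"
    and "CLT_admissible T h \<epsilon> \<U> k n (P, E, \<Phi>)"
  shows "Var_tot T h k n P =
           Var_per T h \<epsilon> \<U> k n + Var_loc T h \<epsilon> \<U> k n + Var_Hoel T h k n E
           + 2 * Cov_per_loc_Hoel T h k n (P, E, \<Phi>)
       \<and> Cov_per_loc_Hoel T h k n (P, E, \<Phi>) \<le>
           sqrt (Var_per T h \<epsilon> \<U> k n * (Var_loc T h \<epsilon> \<U> k n + Var_Hoel T h k n E))"
proof -
  define F where "F = PiE {1..k} E"
  define m where "m = unif_expectation (periodic_points T (k * n)) h"
  define a where "a x i = h ((T ^^ ((i - 1) * n)) (\<Phi> x)) - h (x i)" for x and i :: nat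
  define b where "b x i = h (x i) - m" for x :: "nat \<Rightarrow> 'a" and i
  have loc_min: "is_arg_min (loc_sum h k) (\<lambda>F. F \<in> Pi_min T h \<epsilon> \<U> k n) (P, E, \<Phi>)"
    using assms(11) by (simp add: CLT_admissible_def)
  then have per_min:
      "is_arg_min (per_sum T h k n) (\<lambda>F. F \<in> product_choices T \<epsilon> \<U> k n) (P, E, \<Phi>)"
    by (simp add: is_arg_min_def Pi_min_def)
  then have P: "P \<noteq> {}" "P \<subseteq> periodic_points T (k * n)" and bij: "bij_betw \<Phi> F P"
    by (auto simp: is_arg_min_def product_choices_def locally_independent_def F_def)

  have "finite P"
    using finite_periodic_points[OF assms(1-3), of "k * n"] assms(9,10) P(2)
    by (auto intro: finite_subset)
  then have F: "finite F" "F \<noteq> {}"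
    using bij P(1) bij_betw_finite by (auto simp: bij_betw_def)
  have E: "finite (E i)" "E i \<noteq> {}" if "i \<in> {1..k}" for i
    using finite_nonempty_factors_if_PiE[OF F[unfolded F_def] that] by auto

  have per: "Var_per T h \<epsilon> \<U> k n = (\<Sum>x\<in>F. \<Sum>i=1..k. (a x i)\<^sup>2)"
    unfolding Var_per_def Least_image_eq_arg_min[OF per_min]
    by (simp add: per_sum_def F_def a_def)
  have loc: "Var_loc T h \<epsilon> \<U> k n =
      (\<Sum>x\<in>F. \<Sum>i=1..k. (h (x i) - unif_expectation (E i) h)\<^sup>2)"
    unfolding Var_loc_def Least_image_eq_arg_min[OF loc_min]
    by (simp add: loc_sum_def F_def)

  have "(\<Sum>x\<in>F. \<Sum>i=1..k. (b x i)\<^sup>2) = (\<Sum>i=1..k. \<Sum>x\<in>F. (h (x i) - m)\<^sup>2)"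
    unfolding b_def by (rule sum.swap)
  also have "\<dots> = (\<Sum>i=1..k. (\<Sum>x\<in>F. (h (x i) - unif_expectation (E i) h)\<^sup>2)
      + real (card F) * (unif_expectation (E i) h - m)\<^sup>2)"
    unfolding F_def by (intro sum.cong refl sum_PiE_square_deviation E) auto
  also have "\<dots> = Var_loc T h \<epsilon> \<U> k n + Var_Hoel T h k n E"
    unfolding loc sum.swap[of _ "{1..k}" F]
    by (simp add: sum.distrib sum_distrib_left Var_Hoel_def F_def m_def)
  finally have loc_Hoel:
    "(\<Sum>x\<in>F. \<Sum>i=1..k. (b x i)\<^sup>2) = Var_loc T h \<epsilon> \<U> k n + Var_Hoel T h k n E" .

  have "Cov_per_loc_Hoel T h k n (P, E, \<Phi>) = (\<Sum>x\<in>F. \<Sum>i=1..k.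
      (h ((T ^^ ((i - 1) * n)) (\<Phi> x)) - h (inv_into F \<Phi> (\<Phi> x) i)) *
      (h (inv_into F \<Phi> (\<Phi> x) i) - m))"
    unfolding Cov_per_loc_Hoel_def Let_def prod.case F_def[symmetric] m_def[symmetric]
    by (rule sum.reindex_bij_betw[OF bij, symmetric])
  also have "\<dots> = (\<Sum>x\<in>F. \<Sum>i=1..k. a x i * b x i)"
    using bij by (intro sum.cong refl) (simp add: a_def b_def bij_betw_inv_into_left)
  finally have cov:
    "Cov_per_loc_Hoel T h k n (P, E, \<Phi>) = (\<Sum>x\<in>F. \<Sum>i=1..k. a x i * b x i)" .

  have "Var_tot T h k n P =
      (\<Sum>x\<in>F. \<Sum>i=1..k. (h ((T ^^ ((i - 1) * n)) (\<Phi> x)) - m)\<^sup>2)"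
    unfolding Var_tot_def m_def[symmetric]
    by (rule sum.reindex_bij_betw[OF bij, symmetric])
  also have "\<dots> = (\<Sum>x\<in>F. \<Sum>i=1..k. (a x i)\<^sup>2 + (b x i)\<^sup>2 + 2 * (a x i * b x i))"
    by (intro sum.cong refl) (simp add: a_def b_def power2_eq_square algebra_simps)
  also have "\<dots> = Var_per T h \<epsilon> \<U> k n + (Var_loc T h \<epsilon> \<U> k n + Var_Hoel T h k n E)
      + 2 * Cov_per_loc_Hoel T h k n (P, E, \<Phi>)"
    unfolding per cov loc_Hoel[symmetric] by (simp add: sum.distrib flip: sum_distrib_left)
  finally have total: "Var_tot T h k n P = \<dots>" .

  (* Cauchy--Schwarz over the pairs of a tuple and an index *)
  have "(\<Sum>(x, i)\<in>F \<times> {1..k}. a x i * b x i)\<^sup>2 \<le>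
      (\<Sum>(x, i)\<in>F \<times> {1..k}. (a x i)\<^sup>2) * (\<Sum>(x, i)\<in>F \<times> {1..k}. (b x i)\<^sup>2)"
    using Cauchy_Schwarz_ineq_sum[of "\<lambda>(x, i). a x i" "\<lambda>(x, i). b x i" "F \<times> {1..k}"]
    by (simp add: case_prod_beta)
  then have "(Cov_per_loc_Hoel T h k n (P, E, \<Phi>))\<^sup>2 \<le>
      Var_per T h \<epsilon> \<U> k n * (Var_loc T h \<epsilon> \<U> k n + Var_Hoel T h k n E)"
    unfolding per cov loc_Hoel[symmetric] by (simp add: sum.cartesian_product)
  then show ?thesis
    using total by (simp add: real_le_rsqrt)
qed

end
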